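(* Let $\mathbb{F}$ be a field and let $f:\{0,1\}^n\to\mathbb{F}$ be non-zero. Then $$\mathrm{VC}(f)+\deg_{\mathbb{F}}(f)\ge n.$$ In particular, every non-zero Boolean function $f:\{0,1\}^n\to\{0,1\}$ satisfies $$\mathrm{VC}(f)+\deg(f)\ge n\qquad\text{and}\qquad \mathrm{VC}(f)+\deg_{\mathbb{F}_2}(f)\ge n.$$
   Context: $[n]=\{1,\dots,n\}$. For a field $\mathbb{F}$, every function $f:\{0,1\}^n\to\mathbb{F}$ has a unique multilinear representation $f(x)=\sum_{S\subseteq[n]}c_S x^S$ with $c_S\in\mathbb{F}$ and $x^S=\prod_{i\in S}x_i$ (where $0,1$ are read in $\mathbb{F}$). For non-zero $f$, $\deg_{\mathbb{F}}(f):=\max\{|S|:c_S\neq0\}$. A Boolean function $f:\{0,1\}^n\to\{0,1\}$ may be regarded as $\mathbb{F}$-valued for any field $\mathbb{F}$; $\deg(f)$ denotes $\deg_{\mathbb{R}}(f)$ (the real, equivalently Fourier, degree) and $\deg_{\mathbb{F}_2}(f)$ the degree over the two-element field. The support is $\mathrm{supp}(f):=\{x\in\{0,1\}^n:f(x)\neq0\}$; each $x\in\{0,1\}^n$ is identified with the set $\{i:x_i=1\}\subseteq[n]$, so $\mathrm{supp}(f)$ is viewed as a family of subsets of $[n]$. A family $\mathcal{A}\subseteq 2^{[n]}$ shatters $T\subseteq[n]$ if for every $B\subseteq T$ there is $A\in\mathcal{A}$ with $A\cap T=B$; $\mathrm{VC}(\mathcal{A})$ is the maximum size of a set shattered by $\mathcal{A}$,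 and $\mathrm{VC}(f):=\mathrm{VC}(\mathrm{supp}(f))$. *)

theory Defs
  imports Complex_Main "HOL-Library.FuncSet" "HOL-Library.Z2"
begin

text \<open>Points of \<open>{0,1}\<^sup>n\<close> are functions on \<open>[n] = {1..n}\<close> with values in \<open>{0,1}\<close>, and
  \<open>of_nat\<close> reads these values in a field.  A function on the cube is given by a total HOL function,
  of which only the values on \<open>cube n\<close> matter.\<close>

definition cube :: "nat \<Rightarrow> (nat \<Rightarrow> nat) set" where
  "cube n = {1..n} \<rightarrow>\<^sub>E {0, 1}"

definition multilinear_rep ::
    "nat \<Rightarrow> ((nat \<Rightarrow> nat) \<Rightarrow> 'a::field) \<Rightarrow> (nat set \<Rightarrow> 'a) \<Rightarrow> bool" where
  "multilinear_rep n f c \<longleftrightarrow>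
     (\<forall>x\<in>cube n. f x = (\<Sum>S\<in>Pow {1..n}. c S * (\<Prod>i\<in>S. of_nat (x i))))"

text \<open>Coefficient families are taken in \<open>Pow {1..n} \<rightarrow>\<^sub>E UNIV\<close>, so that they are unique as HOL
  functions; see \<open>ex1_multilinear_rep\<close> below.\<close>

definition multilinear_coeff ::
    "nat \<Rightarrow> ((nat \<Rightarrow> nat) \<Rightarrow> 'a::field) \<Rightarrow> nat set \<Rightarrow> 'a" where
  "multilinear_coeff n f = (THE c. c \<in> Pow {1..n} \<rightarrow>\<^sub>E UNIV \<and> multilinear_rep n f c)"

text \<open>Meaningful only for \<open>f\<close> not identically zero on \<open>cube n\<close>; otherwise this is \<open>Max {}\<close>.
  The field is the codomain type of \<open>f\<close>.\<close>

definition mdeg :: "nat \<Rightarrow> ((nat \<Rightarrow> nat) \<Rightarrow> 'a::field) \<Rightarrow> nat" where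
  "mdeg n f = Max {card S | S. S \<subseteq> {1..n} \<and> multilinear_coeff n f S \<noteq> 0}"

definition supp_family :: "nat \<Rightarrow> ((nat \<Rightarrow> nat) \<Rightarrow> 'b::zero) \<Rightarrow> nat set set" where
  "supp_family n f = {{i\<in>{1..n}. x i = 1} | x. x \<in> cube n \<and> f x \<noteq> 0}"

definition shatters :: "'i set set \<Rightarrow> 'i set \<Rightarrow> bool" where
  "shatters \<A> T \<longleftrightarrow> (\<forall>B. B \<subseteq> T \<longrightarrow> (\<exists>A\<in>\<A>. A \<inter> T = B))"

text \<open>Meaningful only for a nonempty family, since the empty family shatters no set at all.\<close>

definition VC_dim :: "nat \<Rightarrow> nat set set \<Rightarrow> nat" where
  "VC_dim n \<A> = Max {card T | T. T \<subseteq> {1..n} \<and> shatters \<A> T}"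

definition VC :: "nat \<Rightarrow> ((nat \<Rightarrow> nat) \<Rightarrow> 'b::zero) \<Rightarrow> nat" where
  "VC n f = VC_dim n (supp_family n f)"


lemma ex_subset_sum_rep:
  fixes h :: "'i set \<Rightarrow> 'a::ab_group_add"
  assumes "finite U"
  shows "\<exists>c. \<forall>S\<subseteq>U. h S = (\<Sum>T\<in>Pow S. c T)"
  using assms
proof (induction U arbitrary: h rule: finite_induct)
  case empty
  show ?case by (rule exI[of _ h]) simp
next
  case (insert a U)
  obtain c where c: "\<forall>S\<subseteq>U. h S = (\<Sum>T\<in>Pow S. c T)"
    using insert.IH[of h] by blast
  obtain d where d: "\<forall>S\<subseteq>U. h (insert a S) - h S = (\<Sum>T\<in>Pow S. d T)"
    using insert.IH[of "\<lambda>S. h (insert a S) - h S"] by blast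
  define e where "e = (\<lambda>T. if a \<in> T then d (T - {a}) else c T)"
  have low: "h S = (\<Sum>T\<in>Pow S. e T)" if "S \<subseteq> U" for S
  proof -
    have "(\<Sum>T\<in>Pow S. e T) = (\<Sum>T\<in>Pow S. c T)"
      using that insert.hyps by (intro sum.cong) (auto simp: e_def)
    then show ?thesis using c that by simp
  qed
  have high: "h (insert a S) = (\<Sum>T\<in>Pow (insert a S). e T)" if "S \<subseteq> U" for S
  proof -
    have a: "a \<notin> S" and fin: "finite S"
      using that insert.hyps finite_subset by auto
    have inj: "inj_on (insert a) (Pow S)"
      using a by (auto simp: inj_on_def insert_ident)
    have "(\<Sum>T\<in>Pow (insert a S). e T) = (\<Sum>T\<in>Pow S. e T) + (\<Sum>T\<in>insert a ` Pow S. e T)"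
      unfolding Pow_insert using a fin by (intro sum.union_disjoint) auto
    also have "(\<Sum>T\<in>insert a ` Pow S. e T) = (\<Sum>T\<in>Pow S. e (insert a T))"
      using inj by (simp add: sum.reindex)
    also have "\<dots> = (\<Sum>T\<in>Pow S. d T)"
    proof (intro sum.cong refl)
      fix T assume "T \<in> Pow S"
      then have "insert a T - {a} = T" using a by auto
      then show "e (insert a T) = d T" by (simp add: e_def)
    qed
    also have "(\<Sum>T\<in>Pow S. d T) = h (insert a S) - h S"
      using d that by simp
    finally show ?thesis using low[OF that] by simp
  qed
  show ?case
  proof (intro exI[of _ e] allI impI)
    fix S assume S: "S \<subseteq> insert a U"
    show "h S = (\<Sum>T\<in>Pow S. e T)"
    proof (cases "a \<in> S")
      case True
      then have "insert a (S - {a}) = S" by auto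
      moreover have "S - {a} \<subseteq> U" using S by auto
      ultimately show ?thesis using high[of "S - {a}"] by simp
    next
      case False
      then show ?thesis using low S by auto
    qed
  qed
qed

lemma subset_sum_rep_unique:
  fixes c d :: "'i set \<Rightarrow> 'a::ab_group_add"
  assumes "finite S" and "\<And>R. R \<subseteq> S \<Longrightarrow> (\<Sum>T\<in>Pow R. c T) = (\<Sum>T\<in>Pow R. d T)"
  shows "c S = d S"
  using assms
proof (induction S rule: finite_psubset_induct)
  case (psubset S)
  have "(\<Sum>T\<in>Pow S - {S}. c T) = (\<Sum>T\<in>Pow S - {S}. d T)"
  proof (intro sum.cong refl)
    fix T assume "T \<in> Pow S - {S}"
    then have T: "T \<subset> S" by auto
    show "c T = d T"
      using T by (intro psubset.IH psubset.prems) auto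
  qed
  moreover have "(\<Sum>T\<in>Pow S. g T) = g S + (\<Sum>T\<in>Pow S - {S}. g T)" for g :: "'i set \<Rightarrow> 'a"
    using psubset.hyps by (intro sum.remove) auto
  ultimately show ?case using psubset.prems[of S] by auto
qed

lemma monomial_sum_cube:
  fixes c :: "nat set \<Rightarrow> 'a::field"
  assumes "x \<in> cube n"
  shows "(\<Sum>S\<in>Pow {1..n}. c S * (\<Prod>i\<in>S. of_nat (x i))) = (\<Sum>S\<in>Pow {i\<in>{1..n}. x i = 1}. c S)"
proof -
  have val: "(\<Prod>i\<in>S. of_nat (x i)) = (if S \<subseteq> {i\<in>{1..n}. x i = 1} then 1 else 0 :: 'a)"
    if "S \<subseteq> {1..n}" for S
  proof (cases "S \<subseteq> {i\<in>{1..n}. x i = 1}")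
    case True
    then show ?thesis by (auto intro!: prod.neutral)
  next
    case False
    then obtain j where "j \<in> S" "j \<notin> {i\<in>{1..n}. x i = 1}"
      unfolding subset_iff by blast
    then have j: "j \<in> S" "x j \<noteq> 1" using subsetD[OF that] by auto
    then have "x j = 0" using that assms by (auto simp: cube_def PiE_iff)
    then have "(\<Prod>i\<in>S. of_nat (x i)) = (0 :: 'a)"
      using j(1) finite_subset[OF that] \<open>x j = 0\<close> by (intro prod_zero bexI[of _ j]) simp_all
    then show ?thesis using False by simp
  qed
  have "(\<Sum>S\<in>Pow {1..n}. c S * (\<Prod>i\<in>S. of_nat (x i)))
      = (\<Sum>S\<in>Pow {1..n}. if S \<subseteq> {i\<in>{1..n}. x i = 1} then c S else 0)"
    by (intro sum.cong) (auto simp: val)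
  also have "\<dots> = (\<Sum>S\<in>Pow {i\<in>{1..n}. x i = 1}. c S)"
    by (intro sum.mono_neutral_cong_right) auto
  finally show ?thesis .
qed

definition cube_point :: "nat \<Rightarrow> nat set \<Rightarrow> nat \<Rightarrow> nat" where
  "cube_point n S = (\<lambda>i\<in>{1..n}. if i \<in> S then 1 else 0)"

lemma cube_point_in: "cube_point n S \<in> cube n"
  by (auto simp: cube_def cube_point_def)

lemma ones_cube_point: "S \<subseteq> {1..n} \<Longrightarrow> {i\<in>{1..n}. cube_point n S i = 1} = S"
  by (auto simp: cube_point_def)

lemma cube_point_ones: "x \<in> cube n \<Longrightarrow> cube_point n {i\<in>{1..n}. x i = 1} = x"
  by (rule ext) (auto simp: cube_def cube_point_def PiE_iff extensional_def)

lemma multilinear_rep_iff: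
  "multilinear_rep n f c \<longleftrightarrow> (\<forall>S\<subseteq>{1..n}. f (cube_point n S) = (\<Sum>T\<in>Pow S. c T))"
proof
  assume L: "multilinear_rep n f c"
  show "\<forall>S\<subseteq>{1..n}. f (cube_point n S) = (\<Sum>T\<in>Pow S. c T)"
  proof (intro allI impI)
    fix S assume S: "S \<subseteq> {1..n}"
    have "f (cube_point n S) = (\<Sum>T\<in>Pow {1..n}. c T * (\<Prod>i\<in>T. of_nat (cube_point n S i)))"
      by (rule bspec[OF L[unfolded multilinear_rep_def] cube_point_in])
    also have "\<dots> = (\<Sum>T\<in>Pow {i\<in>{1..n}. cube_point n S i = 1}. c T)"
      by (rule monomial_sum_cube[OF cube_point_in])
    also have "{i\<in>{1..n}. cube_point n S i = 1} = S"
      by (rule ones_cube_point[OF S])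
    finally show "f (cube_point n S) = (\<Sum>T\<in>Pow S. c T)" .
  qed
next
  assume R: "\<forall>S\<subseteq>{1..n}. f (cube_point n S) = (\<Sum>T\<in>Pow S. c T)"
  show "multilinear_rep n f c"
    unfolding multilinear_rep_def
  proof
    fix x assume x: "x \<in> cube n"
    have "f x = f (cube_point n {i\<in>{1..n}. x i = 1})"
      by (simp only: cube_point_ones[OF x])
    also have "\<dots> = (\<Sum>T\<in>Pow {i\<in>{1..n}. x i = 1}. c T)"
      by (rule R[rule_format]) blast
    also have "\<dots> = (\<Sum>S\<in>Pow {1..n}. c S * (\<Prod>i\<in>S. of_nat (x i)))"
      by (rule monomial_sum_cube[OF x, symmetric])
    finally show "f x = (\<Sum>S\<in>Pow {1..n}. c S * (\<Prod>i\<in>S. of_nat (x i)))" .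
  qed
qed

lemma ex1_multilinear_rep:
  fixes f :: "(nat \<Rightarrow> nat) \<Rightarrow> 'a::field"
  shows "\<exists>!c. c \<in> Pow {1..n} \<rightarrow>\<^sub>E UNIV \<and> multilinear_rep n f c"
proof -
  obtain c where c: "\<forall>S\<subseteq>{1..n}. f (cube_point n S) = (\<Sum>T\<in>Pow S. c T)"
    using ex_subset_sum_rep[of "{1..n}" "\<lambda>S. f (cube_point n S)"] by auto
  have "f (cube_point n S) = (\<Sum>T\<in>Pow S. restrict c (Pow {1..n}) T)" if "S \<subseteq> {1..n}" for S
  proof -
    have "(\<Sum>T\<in>Pow S. restrict c (Pow {1..n}) T) = (\<Sum>T\<in>Pow S. c T)"
      using that by (intro sum.cong) auto
    then show ?thesis using c that by simp
  qed
  then have ex: "restrict c (Pow {1..n}) \<in> Pow {1..n} \<rightarrow>\<^sub>E UNIV \<and>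
      multilinear_rep n f (restrict c (Pow {1..n}))"
    by (simp add: multilinear_rep_iff)
  have uniq: "d = e"
    if d: "d \<in> Pow {1..n} \<rightarrow>\<^sub>E UNIV \<and> multilinear_rep n f d"
      and e: "e \<in> Pow {1..n} \<rightarrow>\<^sub>E UNIV \<and> multilinear_rep n f e" for d e
  proof (rule PiE_ext[OF conjunct1[OF d] conjunct1[OF e]])
    fix S assume "S \<in> Pow {1..n}"
    then have S: "S \<subseteq> {1..n}" by simp
    show "d S = e S"
    proof (rule subset_sum_rep_unique)
      show "finite S" using finite_subset[OF S] by simp
      fix R assume "R \<subseteq> S"
      then have "R \<subseteq> {1..n}" using S by (rule subset_trans)
      then show "(\<Sum>T\<in>Pow R. d T) = (\<Sum>T\<in>Pow R. e T)"
        using conjunct2[OF d] conjunct2[OF e] by (simp add: multilinear_rep_iff)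
    qed
  qed
  show ?thesis
  proof (rule ex1I)
    show "restrict c (Pow {1..n}) \<in> Pow {1..n} \<rightarrow>\<^sub>E UNIV \<and>
        multilinear_rep n f (restrict c (Pow {1..n}))"
      by (rule ex)
  qed (rule uniq[OF _ ex])
qed

end

theory Submission
  imports Defs
begin

text \<open>Let \<open>S\<close> be a monomial of \<open>f\<close> of maximal size.  Its complement \<open>{1..n} - S\<close>, of size
  \<open>n - deg f\<close>, is shattered by the support of \<open>f\<close>.  Indeed, fix the variables outside \<open>S\<close> to the
  indicator of some \<open>B\<close>.  What remains is a polynomial in the variables of \<open>S\<close>, in which the
  coefficient of \<open>x\<^sup>S\<close> is the sum of the coefficients of \<open>f\<close> at \<open>S \<union> W\<close> over \<open>W \<subseteq> B\<close>.  No monomial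
  of \<open>f\<close> properly contains \<open>S\<close>, so only \<open>W = {}\<close> contributes and this coefficient is non-zero
  (\<open>ex_subset_sum_nonzero\<close>).  By uniqueness of multilinear representations the restricted function
  is not identically zero, which yields a point of the support whose trace outside \<open>S\<close> is \<open>B\<close>
  (\<open>shatters_complement_of_maximal_monomial\<close>).  The Boolean cases follow because reading a
  \<open>{0,1}\<close>-valued function in a field does not change its support.\<close>

lemma sum_Pow_Un_disjoint:
  fixes c :: "'i set \<Rightarrow> 'a::comm_monoid_add"
  assumes "R \<inter> B = {}"
  shows "(\<Sum>T\<in>Pow (R \<union> B). c T) = (\<Sum>Q\<in>Pow R. \<Sum>W\<in>Pow B. c (Q \<union> W))"
proof -
  have "(\<Sum>T\<in>Pow (R \<union> B). c T) = (\<Sum>(Q, W)\<in>Pow R \<times> Pow B. c (Q \<union> W))"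
  proof (rule sum.reindex_bij_witness[of _ "\<lambda>(Q, W). Q \<union> W" "\<lambda>T. (T \<inter> R, T \<inter> B)"])
    fix T assume "T \<in> Pow (R \<union> B)"
    then have "(T \<inter> R) \<union> (T \<inter> B) = T" by auto
    then show "(case (T \<inter> R, T \<inter> B) of (Q, W) \<Rightarrow> Q \<union> W) = T"
      and "(case (T \<inter> R, T \<inter> B) of (Q, W) \<Rightarrow> c (Q \<union> W)) = c T"
      by simp_all
  qed (use assms in auto)
  then show ?thesis by (simp add: sum.cartesian_product)
qed

text \<open>The subset sums on the sets \<open>R \<union> B\<close> with \<open>R \<subseteq> S\<close> are the values of the function restricted to
  a subcube; by uniqueness they can vanish throughout only if the coefficient of the restriction
  at \<open>S\<close> vanishes, and maximality of \<open>S\<close> makes that coefficient \<open>c S\<close>.\<close>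

lemma ex_subset_sum_nonzero:
  fixes c :: "'i set \<Rightarrow> 'a::ab_group_add"
  assumes fin: "finite S" "finite B" and disj: "S \<inter> B = {}"
    and nz: "c S \<noteq> 0"
    and maximal: "\<And>W. W \<subseteq> B \<Longrightarrow> W \<noteq> {} \<Longrightarrow> c (S \<union> W) = 0"
  shows "\<exists>R\<subseteq>S. (\<Sum>T\<in>Pow (R \<union> B). c T) \<noteq> 0"
proof (rule ccontr)
  assume "\<not> ?thesis"
  then have vanish: "(\<Sum>T\<in>Pow (R \<union> B). c T) = 0" if "R \<subseteq> S" for R
    using that by blast
  have "(\<Sum>W\<in>Pow B. c (S \<union> W)) = 0"
  proof (rule subset_sum_rep_unique[of S "\<lambda>Q. \<Sum>W\<in>Pow B. c (Q \<union> W)" "\<lambda>_. 0"])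
    fix R assume R: "R \<subseteq> S"
    then have "R \<inter> B = {}" using disj by blast
    then show "(\<Sum>Q\<in>Pow R. \<Sum>W\<in>Pow B. c (Q \<union> W)) = (\<Sum>Q\<in>Pow R. 0)"
      using vanish[OF R] by (simp add: sum_Pow_Un_disjoint)
  qed (rule fin)
  moreover have "(\<Sum>W\<in>Pow B. c (S \<union> W)) = (\<Sum>W\<in>{{}}. c (S \<union> W))"
    using fin maximal by (intro sum.mono_neutral_right) auto
  ultimately show False using nz by simp
qed

lemma multilinear_rep_multilinear_coeff: "multilinear_rep n f (multilinear_coeff n f)"
  unfolding multilinear_coeff_def using theI'[OF ex1_multilinear_rep[of n f]] by blast

lemma eval_cube_point:
  "S \<subseteq> {1..n} \<Longrightarrow> f (cube_point n S) = (\<Sum>T\<in>Pow S. multilinear_coeff n f T)"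
  using multilinear_rep_multilinear_coeff[of n f] by (simp add: multilinear_rep_iff)

lemma ex_nonzero_coeff:
  assumes "x \<in> cube n" "f x \<noteq> 0"
  shows "\<exists>S\<subseteq>{1..n}. multilinear_coeff n f S \<noteq> 0"
proof -
  let ?A = "{i\<in>{1..n}. x i = 1}"
  have sub: "?A \<subseteq> {1..n}" by blast
  have "(\<Sum>T\<in>Pow ?A. multilinear_coeff n f T) \<noteq> 0"
    using eval_cube_point[of ?A n f] sub assms by (simp only: cube_point_ones[OF assms(1)]) simp
  then obtain T where "T \<in> Pow ?A" "multilinear_coeff n f T \<noteq> 0"
    by (rule sum.not_neutral_contains_not_neutral)
  then show ?thesis using sub by blast
qed

lemma finite_card_subsets: "finite {card S | S. S \<subseteq> {1..n::nat} \<and> P S}"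
  by (rule finite_subset[of _ "card ` Pow {1..n}"]) auto

lemma mdeg_attained:
  assumes "\<exists>x\<in>cube n. f x \<noteq> 0"
  obtains S where "S \<subseteq> {1..n}" "multilinear_coeff n f S \<noteq> 0" "card S = mdeg n f"
proof -
  have "mdeg n f \<in> {card S | S. S \<subseteq> {1..n} \<and> multilinear_coeff n f S \<noteq> 0}"
    unfolding mdeg_def
  proof (rule Max_in)
    show "{card S | S. S \<subseteq> {1..n} \<and> multilinear_coeff n f S \<noteq> 0} \<noteq> {}"
    proof -
      obtain S where "S \<subseteq> {1..n}" "multilinear_coeff n f S \<noteq> 0"
        using assms ex_nonzero_coeff by metis
      then show ?thesis by blast
    qed
  qed (rule finite_card_subsets)
  then show thesis using that by auto
qed

lemma card_le_mdeg:
  "S \<subseteq> {1..n} \<Longrightarrow> multilinear_coeff n f S \<noteq> 0 \<Longrightarrow> card S \<le> mdeg n f"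
  unfolding mdeg_def by (intro Max_ge finite_card_subsets) blast

lemma card_le_VC:
  "T \<subseteq> {1..n} \<Longrightarrow> shatters (supp_family n f) T \<Longrightarrow> card T \<le> VC n f"
  unfolding VC_def VC_dim_def by (intro Max_ge finite_card_subsets) blast

lemma in_supp_family:
  assumes "A \<subseteq> {1..n}" "f (cube_point n A) \<noteq> 0"
  shows "A \<in> supp_family n f"
  unfolding supp_family_def mem_Collect_eq
  using ones_cube_point[OF assms(1)] cube_point_in[of n A] assms(2)
  by (intro exI[of _ "cube_point n A"] conjI) (rule sym)

text \<open>Every assignment to the variables outside \<open>S\<close> extends to a point of the support, because the
  restriction of \<open>f\<close> under the assignment is a polynomial in the variables of \<open>S\<close> in which \<open>x\<^sup>S\<close>
  keeps its coefficient.\<close>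

lemma shatters_complement_of_maximal_monomial:
  assumes S: "S \<subseteq> {1..n}" "multilinear_coeff n f S \<noteq> 0"
    and maximal: "\<And>U. S \<subset> U \<Longrightarrow> U \<subseteq> {1..n} \<Longrightarrow> multilinear_coeff n f U = 0"
  shows "shatters (supp_family n f) ({1..n} - S)"
  unfolding shatters_def
proof (intro allI impI)
  fix B assume B: "B \<subseteq> {1..n} - S"
  have "\<exists>R\<subseteq>S. (\<Sum>T\<in>Pow (R \<union> B). multilinear_coeff n f T) \<noteq> 0"
  proof (rule ex_subset_sum_nonzero)
    show "finite S" "finite B"
      using S(1) B by (meson finite_subset finite_atLeastAtMost finite_Diff)+
    show "S \<inter> B = {}" using B by blast
    show "multilinear_coeff n f S \<noteq> 0" by (rule S(2))
    fix W assume "W \<subseteq> B" "W \<noteq> {}"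
    then show "multilinear_coeff n f (S \<union> W) = 0"
      using S(1) B by (intro maximal) blast+
  qed
  then obtain R where R: "R \<subseteq> S" "(\<Sum>T\<in>Pow (R \<union> B). multilinear_coeff n f T) \<noteq> 0"
    by blast
  have sub: "R \<union> B \<subseteq> {1..n}" using R(1) S(1) B by blast
  have "R \<union> B \<in> supp_family n f"
    using sub R(2) by (intro in_supp_family) (simp_all add: eval_cube_point)
  moreover have "(R \<union> B) \<inter> ({1..n} - S) = B" using R(1) B by blast
  ultimately show "\<exists>A\<in>supp_family n f. A \<inter> ({1..n} - S) = B" by blast
qed

lemma VC_plus_mdeg_ge:
  fixes f :: "(nat \<Rightarrow> nat) \<Rightarrow> 'a::field"
  assumes "\<exists>x\<in>cube n. f x \<noteq> 0"
  shows "n \<le> VC n f + mdeg n f"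
proof -
  obtain S where S: "S \<subseteq> {1..n}" "multilinear_coeff n f S \<noteq> 0" "card S = mdeg n f"
    using mdeg_attained[OF assms] .
  have "multilinear_coeff n f U = 0" if "S \<subset> U" "U \<subseteq> {1..n}" for U
  proof (rule ccontr)
    assume "multilinear_coeff n f U \<noteq> 0"
    then have "card U \<le> card S" using card_le_mdeg that(2) S(3) by metis
    moreover have "card S < card U"
      using that by (intro psubset_card_mono) (auto intro: finite_subset)
    ultimately show False by simp
  qed
  then have "card ({1..n} - S) \<le> VC n f"
    using S by (intro card_le_VC shatters_complement_of_maximal_monomial) auto
  moreover have "card ({1..n} - S) = n - mdeg n f"
    using S by (simp add: card_Diff_subset finite_subset[of _ "{1..n}"])
  ultimately show ?thesis by linarith
qed

lemma VC_cong_support: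
  assumes "\<And>x. x \<in> cube n \<Longrightarrow> f x \<noteq> 0 \<longleftrightarrow> g x \<noteq> 0"
  shows "VC n f = VC n g"
proof -
  have "supp_family n f = supp_family n g"
    unfolding supp_family_def using assms by blast
  then show ?thesis by (simp add: VC_def)
qed

lemma VC_plus_mdeg_of_nat_ge:
  fixes g :: "(nat \<Rightarrow> nat) \<Rightarrow> nat"
  assumes "g \<in> cube n \<rightarrow> {0, 1}" "\<exists>x\<in>cube n. g x \<noteq> 0"
  shows "n \<le> VC n g + mdeg n (\<lambda>x. of_nat (g x) :: 'b::field)"
proof -
  \<comment> \<open>Values beyond \<open>0\<close> and \<open>1\<close> could vanish in positive characteristic.\<close>
  have supp: "g x \<noteq> 0 \<longleftrightarrow> (of_nat (g x) :: 'b) \<noteq> 0" if "x \<in> cube n" for x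
    using assms(1) that by (auto simp: Pi_iff)
  then have "n \<le> VC n (\<lambda>x. of_nat (g x) :: 'b) + mdeg n (\<lambda>x. of_nat (g x) :: 'b)"
    using assms(2) by (intro VC_plus_mdeg_ge) blast
  moreover have "VC n g = VC n (\<lambda>x. of_nat (g x) :: 'b)"
    using supp by (rule VC_cong_support)
  ultimately show ?thesis by simp
qed

theorem corollary1p3:
  fixes n :: nat
  shows "(\<forall>f :: (nat \<Rightarrow> nat) \<Rightarrow> 'a::field.
            (\<exists>x\<in>cube n. f x \<noteq> 0) \<longrightarrow> VC n f + mdeg n f \<ge> n) \<and>
         (\<forall>g :: (nat \<Rightarrow> nat) \<Rightarrow> nat.
            g \<in> cube n \<rightarrow> {0, 1} \<and> (\<exists>x\<in>cube n. g x \<noteq> 0) \<longrightarrow>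
              VC n g + mdeg n (\<lambda>x. of_nat (g x) :: real) \<ge> n \<and>
              VC n g + mdeg n (\<lambda>x. of_nat (g x) :: bit) \<ge> n)"
  by (intro conjI allI impI; (elim conjE)?)
     (rule VC_plus_mdeg_ge VC_plus_mdeg_of_nat_ge; assumption)+

end
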